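(* Let $X_1,\dots,X_n$ be an i.i.d. sample from a distribution $P$, and let $\mu\in\mathcal{M}$ be a certain characteristic of $P$ (a fixed point determined by $P$), where $(\mathcal{M},d)$ is a complete separable metric space. Let $\delta\in(0,1)$ and $K=\lceil 8\log(\delta^{-1})\rceil$, and assume that $n/K=\ell\in\mathbb{N}$, $\ell\ge 1$. Split the sample into $K$ disjoint groups of size $\ell$, and let $\mu_1,\dots,\mu_K$ be the $K$ estimators of $\mu$, with values in $\mathcal{M}$, obtained from the respective groups. Let $\mu^*$ be the aggregated estimator, i.e. a minimizer over $\nu\in\mathcal{M}$ of $$\nu\mapsto \min_{I\subset\{1,\dots,K\}:\,|I|>K/2}\ \max_{j\in I} d(\mu_j,\nu).$$ Then $$\mathbb{P}\left(d(\mu^*,\mu)>4\sqrt{\mathbb{E}\, d^2(\mu_1,\mu)}\right)\le\delta .$$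
   Context: The estimators $\mu_1,\dots,\mu_K$ are obtained by applying the same estimation procedure (a measurable $\mathcal{M}$-valued function of $\ell$ observations) to each of the $K$ disjoint groups, so they are independent and identically distributed random elements of $\mathcal{M}$. The minimizer need not be unique; $\mu^*$ is an arbitrarily chosen minimizer (a random element of $\mathcal{M}$). $\log$ is the natural logarithm, $\lceil x\rceil$ the ceiling of $x$, and $d^2(a,b)=d(a,b)^2$. *)

theory Defs
  imports "HOL-Probability.Probability"
begin

text \<open>
  \<open>g (j, i)\<close> is the position in the sample of the \<open>i\<close>-th observation of the \<open>j\<close>-th group.
\<close>

definition is_split :: "nat \<Rightarrow> nat \<Rightarrow> nat \<Rightarrow> (nat \<times> nat \<Rightarrow> nat) \<Rightarrow> bool" where
  "is_split n K L g \<longleftrightarrow> bij_betw g ({1..K} \<times> {1..L}) {1..n}"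

text \<open>
  An estimation procedure \<open>T\<close> is a function of \<open>L\<close> observations, which are passed as an
  element of the product space \<open>\<Pi>\<^sub>M i\<in>{1..L}. P\<close>.
\<close>

definition group_estimator ::
  "((nat \<Rightarrow> 's) \<Rightarrow> 'm) \<Rightarrow> (nat \<Rightarrow> 'w \<Rightarrow> 's) \<Rightarrow> (nat \<times> nat \<Rightarrow> nat) \<Rightarrow> nat \<Rightarrow> nat \<Rightarrow> 'w \<Rightarrow> 'm" where
  "group_estimator T X g L j = (\<lambda>\<omega>. T (\<lambda>i\<in>{1..L}. X (g (j, i)) \<omega>))"

definition majority_radius :: "nat \<Rightarrow> (nat \<Rightarrow> 'm::metric_space) \<Rightarrow> 'm \<Rightarrow> real" where
  "majority_radius K m \<nu> =
     (MIN I\<in>{I. I \<subseteq> {1..K} \<and> real (card I) > real K / 2}. MAX j\<in>I. dist (m j) \<nu>)"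

text \<open>
  The square root on \<open>[0, \<infinity>]\<close>. Taking the second moment as a nonnegative integral with values
  in \<open>[0, \<infinity>]\<close> avoids an integrability assumption: a Bochner integral would
  be \<open>0\<close> when the second moment is infinite.
\<close>

definition ennreal_sqrt :: "ennreal \<Rightarrow> ennreal" where
  "ennreal_sqrt x = (if x = \<infinity> then \<infinity> else ennreal (sqrt (enn2real x)))"

end

theory Submission
  imports Defs
begin

text \<open>
  Let \<open>s\<close> be the square root of the second moment. By Chebyshev's inequality each group estimator
  is farther than \<open>2s\<close> from \<open>\<mu>\<close> with probability at most \<open>1/4\<close>, so by Hoeffding's inequality
  at least half of them are only with probability at most \<open>exp (- K / 8) \<le> \<delta>\<close>. Otherwise
  a strict majority lies within \<open>2s\<close> of \<open>\<mu>\<close>, hence the minimal majority radius is at most \<open>2s\<close>, and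
  a strict majority lies within \<open>2s\<close> of the minimizer as well. Two strict majorities intersect,
  which bounds the distance between \<open>\<mu>\<close> and the minimizer by \<open>4s\<close>.
\<close>

subsection \<open>Majority radius\<close>

lemma majority_radius_le:
  assumes I: "I \<subseteq> {1..K}" "real (card I) > real K / 2"
    and r: "\<And>j. j \<in> I \<Longrightarrow> dist (m j) \<nu> \<le> r"
  shows "majority_radius K m \<nu> \<le> r"
proof -
  have fin: "finite I" using I(1) by (rule finite_subset) simp
  \<comment> \<open>A strict majority contains some index, so \<open>MAX\<close> is taken over a
    nonempty set and has its usual meaning.\<close>
  have ne: "I \<noteq> {}" using I(2) by auto
  have "majority_radius K m \<nu> \<le> (MAX j\<in>I. dist (m j) \<nu>)"
    unfolding majority_radius_def using I by (intro Min_le) auto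
  also have "\<dots> \<le> r" using fin ne r by simp
  finally show ?thesis .
qed

lemma majority_radius_leE:
  assumes "K > 0" "majority_radius K m \<nu> \<le> r"
  obtains I where "I \<subseteq> {1..K}" "real (card I) > real K / 2" "\<And>j. j \<in> I \<Longrightarrow> dist (m j) \<nu> \<le> r"
proof -
  let ?\<I> = "{I. I \<subseteq> {1..K} \<and> real (card I) > real K / 2}"
  \<comment> \<open>Since \<open>K > 0\<close>, the full index set is a strict majority. The minimum
    therefore runs over a nonempty finite family and is attained.\<close>
  have "{1..K} \<in> ?\<I>" using assms(1) by simp
  then have "majority_radius K m \<nu> \<in> (\<lambda>I. MAX j\<in>I. dist (m j) \<nu>) ` ?\<I>"
    unfolding majority_radius_def by (intro Min_in) auto
  then obtain I where I: "I \<in> ?\<I>" and eq: "majority_radius K m \<nu> = (MAX j\<in>I. dist (m j) \<nu>)"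
    by blast
  have "finite I" using I by (auto intro: finite_subset)
  have "dist (m j) \<nu> \<le> r" if "j \<in> I" for j
  proof -
    have "dist (m j) \<nu> \<le> (MAX j\<in>I. dist (m j) \<nu>)"
      using \<open>finite I\<close> that by (intro Max_ge) auto
    with assms(2) eq show ?thesis by simp
  qed
  with I show thesis by (intro that[of I]) auto
qed

lemma dist_arg_min_majority_radius_le:
  assumes K: "K > 0"
    and min: "is_arg_min (majority_radius K m) (\<lambda>_. True) \<nu>"
    and maj: "real (card {j\<in>{1..K}. dist (m j) \<mu> \<le> r}) > real K / 2"
  shows "dist \<nu> \<mu> \<le> 2 * r"
proof -
  let ?J = "{j\<in>{1..K}. dist (m j) \<mu> \<le> r}"
  \<comment> \<open>Minimality enters only here, by comparison with the single competitor
    \<open>\<mu>\<close>.\<close>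
  have "majority_radius K m \<nu> \<le> majority_radius K m \<mu>"
    using min by (simp add: is_arg_min_def not_less)
  also have "\<dots> \<le> r" using maj by (intro majority_radius_le[of ?J]) auto
  finally obtain I where I: "I \<subseteq> {1..K}" "real (card I) > real K / 2"
      "\<And>j. j \<in> I \<Longrightarrow> dist (m j) \<nu> \<le> r"
    using K by (elim majority_radius_leE[rotated]) auto
  \<comment> \<open>Disjoint strict majorities would together have more than \<open>K\<close>
    elements.\<close>
  have "I \<inter> ?J \<noteq> {}"
  proof
    assume "I \<inter> ?J = {}"
    then have "card I + card ?J = card (I \<union> ?J)"
      using I(1) by (intro card_Un_disjoint[symmetric]) (auto intro: finite_subset)
    also have "\<dots> \<le> card {1..K}" using I(1) by (intro card_mono) auto
    finally show False using I(2) maj by simp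
  qed
  then obtain j where "j \<in> I" "dist (m j) \<mu> \<le> r" by auto
  then show ?thesis using I(3)[of j] dist_triangle3[of \<nu> \<mu> "m j"] by simp
qed

subsection \<open>Independent groups\<close>

context prob_space
begin

text \<open>Each \<open>X (f i)\<close> is a function of the one-element block \<open>{f i}\<close>.
  Injectivity of \<open>f\<close> makes these blocks disjoint, and functions of disjoint blocks of
  independent variables are independent.\<close>

lemma indep_vars_reindex_inj:
  assumes ind: "indep_vars M' X J" and inj: "inj_on f I" and sub: "f ` I \<subseteq> J"
  shows "indep_vars (\<lambda>i. M' (f i)) (\<lambda>i. X (f i)) I"
proof -
  have "indep_vars (\<lambda>i. PiM {f i} M') (\<lambda>i \<omega>. restrict (\<lambda>k. X k \<omega>) {f i}) I"
    using sub inj by (intro indep_vars_restrict[OF ind])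
      (auto simp: disjoint_family_on_def inj_on_def)
  then have "indep_vars (\<lambda>i. M' (f i))
      (\<lambda>i \<omega>. (\<lambda>h. h (f i)) (restrict (\<lambda>k. X k \<omega>) {f i})) I"
    by (rule indep_vars_compose2) simp
  then show ?thesis by simp
qed

lemma distr_iid_PiM:
  assumes ind: "indep_vars (\<lambda>_. P) X I" and "I \<noteq> {}"
    and distr: "\<And>i. i \<in> I \<Longrightarrow> distr M P (X i) = P"
  shows "distr M (PiM I (\<lambda>_. P)) (\<lambda>\<omega>. \<lambda>i\<in>I. X i \<omega>) = PiM I (\<lambda>_. P)"
proof -
  have "distr M (PiM I (\<lambda>_. P)) (\<lambda>\<omega>. \<lambda>i\<in>I. X i \<omega>) = PiM I (\<lambda>i. distr M P (X i))"
    using ind assms(2)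
    by (subst indep_vars_iff_distr_eq_PiM'[symmetric]) (auto simp: indep_vars_def)
  also have "\<dots> = PiM I (\<lambda>_. P)" using distr by (intro PiM_cong) auto
  finally show ?thesis .
qed

context
  fixes P :: "'s measure" and X :: "nat \<Rightarrow> 'a \<Rightarrow> 's" and T :: "(nat \<Rightarrow> 's) \<Rightarrow> 'm::topological_space"
    and g :: "nat \<times> nat \<Rightarrow> nat" and n K L :: nat
  assumes ind: "indep_vars (\<lambda>_. P) X {1..n}"
    and split: "is_split n K L g"
    and T: "T \<in> (\<Pi>\<^sub>M i\<in>{1..L}. P) \<rightarrow>\<^sub>M borel"
begin

text \<open>The positions \<open>B j\<close> of different groups are disjoint because
  \<open>g\<close> is injective on pairs, so the estimators are functions of disjoint blocks of the
  independent sample.\<close>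

lemma indep_vars_group_estimator: "indep_vars (\<lambda>_. borel) (group_estimator T X g L) {1..K}"
proof -
  define B where "B = (\<lambda>j. g ` ({j} \<times> {1..L}))"
  have inj: "inj_on g ({1..K} \<times> {1..L})" and im: "g ` ({1..K} \<times> {1..L}) = {1..n}"
    using split by (auto simp: is_split_def bij_betw_def)
  have "indep_vars (\<lambda>j. PiM (B j) (\<lambda>_. P)) (\<lambda>j \<omega>. restrict (\<lambda>k. X k \<omega>) (B j)) {1..K}"
  proof (rule indep_vars_restrict[OF ind])
    show "B j \<subseteq> {1..n}" if "j \<in> {1..K}" for j
      unfolding B_def im[symmetric] using that by (intro image_mono) auto
    show "disjoint_family_on B {1..K}"
      unfolding disjoint_family_on_def
    proof (intro ballI impI)
      fix i j assume "i \<in> {1..K}" "j \<in> {1..K}" "i \<noteq> j"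
      then show "B i \<inter> B j = {}"
        unfolding B_def by (subst inj_on_image_Int[OF inj, symmetric]) auto
    qed
  qed
  then have "indep_vars (\<lambda>_. borel)
      (\<lambda>j \<omega>. (\<lambda>h. T (\<lambda>i\<in>{1..L}. h (g (j, i)))) (restrict (\<lambda>k. X k \<omega>) (B j))) {1..K}"
  proof (rule indep_vars_compose2)
    fix j
    have "(\<lambda>h. \<lambda>i\<in>{1..L}. h (g (j, i))) \<in> PiM (B j) (\<lambda>_. P) \<rightarrow>\<^sub>M (\<Pi>\<^sub>M i\<in>{1..L}. P)"
      by (intro measurable_restrict measurable_component_singleton) (auto simp: B_def)
    then show "(\<lambda>h. T (\<lambda>i\<in>{1..L}. h (g (j, i)))) \<in> PiM (B j) (\<lambda>_. P) \<rightarrow>\<^sub>M borel"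
      by (rule measurable_compose[OF _ T])
  qed
  \<comment> \<open>The estimator of group \<open>j\<close> reads only positions in
    \<open>B j\<close>, so restricting the sample to this block does not change it.\<close>
  moreover have "T (\<lambda>i\<in>{1..L}. restrict (\<lambda>k. X k \<omega>) (B j) (g (j, i)))
      = group_estimator T X g L j \<omega>" for j \<omega>
    unfolding group_estimator_def by (intro arg_cong[of _ _ T] restrict_ext) (simp add: B_def)
  ultimately show ?thesis by simp
qed

text \<open>The observations of a group have the product measure as joint law, and \<open>T\<close>
  pushes it forward. Since the resulting law does not depend on \<open>j\<close>, the estimators are
  identically distributed.\<close>

lemma distr_group_estimator:
  assumes distr: "\<And>i. i \<in> {1..n} \<Longrightarrow> distr M P (X i) = P"
    and L: "L \<ge> 1" and j: "j \<in> {1..K}"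
  shows "distr M borel (group_estimator T X g L j) = distr (\<Pi>\<^sub>M i\<in>{1..L}. P) borel T"
proof -
  have g: "g (j, i) \<in> {1..n}" if "i \<in> {1..L}" for i
    using split j that by (auto simp: is_split_def bij_betw_def)
  have ind': "indep_vars (\<lambda>_. P) (\<lambda>i. X (g (j, i))) {1..L}"
  proof (rule indep_vars_reindex_inj[OF ind])
    have "inj_on g ({1..K} \<times> {1..L})" using split by (simp add: is_split_def bij_betw_def)
    then show "inj_on (\<lambda>i. g (j, i)) {1..L}" using j by (intro inj_onI) (auto dest: inj_onD)
  qed (use g in auto)
  then have meas: "(\<lambda>\<omega>. \<lambda>i\<in>{1..L}. X (g (j, i)) \<omega>) \<in> M \<rightarrow>\<^sub>M (\<Pi>\<^sub>M i\<in>{1..L}. P)"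
    by (intro measurable_restrict) (auto simp: indep_vars_def)
  have "distr M borel (group_estimator T X g L j) =
      distr (distr M (\<Pi>\<^sub>M i\<in>{1..L}. P) (\<lambda>\<omega>. \<lambda>i\<in>{1..L}. X (g (j, i)) \<omega>)) borel T"
    by (subst distr_distr[OF T meas]) (simp add: group_estimator_def comp_def)
  then show ?thesis using L distr g by (subst (asm) distr_iid_PiM[OF ind']) auto
qed

end

subsection \<open>Tail bounds\<close>

text \<open>Markov's inequality for the square of \<open>Y\<close> at level
  \<open>(2 * s)\<^sup>2\<close> gives the quotient 1/4.\<close>

lemma prob_gt_twice_root_second_moment_le:
  fixes Y :: "'a \<Rightarrow> real"
  assumes [measurable]: "Y \<in> borel_measurable M"
    and moment: "(\<integral>\<^sup>+ \<omega>. ennreal ((Y \<omega>)\<^sup>2) \<partial>M) = ennreal (s\<^sup>2)" and s: "s \<ge> 0"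
  shows "prob {\<omega>\<in>space M. Y \<omega> > 2 * s} \<le> 1 / 4"
\<comment> \<open>For \<open>s = 0\<close> Markov's inequality would divide by zero. Here
  \<open>Y\<close> vanishes almost everywhere, and the event is null because its inequality is
  strict.\<close>
proof (cases "s = 0")
  case True
  then have "AE \<omega> in M. ennreal ((Y \<omega>)\<^sup>2) = 0"
    using moment by (subst nn_integral_0_iff_AE[symmetric]) auto
  then have "AE \<omega> in M. \<not> Y \<omega> > 2 * s" using True by (auto elim!: eventually_mono)
  then have "prob {\<omega>\<in>space M. Y \<omega> > 2 * s} = 0"
    by (subst prob_eq_0) auto
  then show ?thesis by simp
next
  case False
  have int: "integrable M (\<lambda>\<omega>. (Y \<omega>)\<^sup>2)"
    using moment by (intro integrableI_nonneg) auto
  have E: "expectation (\<lambda>\<omega>. (Y \<omega>)\<^sup>2) = s\<^sup>2"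
    using moment by (intro integral_eq_nn_integral[THEN trans]) auto
  have "prob {\<omega>\<in>space M. Y \<omega> > 2 * s} \<le> prob {\<omega>\<in>space M. (Y \<omega>)\<^sup>2 \<ge> (2 * s)\<^sup>2}"
    by (intro finite_measure_mono subsetI CollectI conjI power_mono) (use s in auto)
  also have "\<dots> \<le> expectation (\<lambda>\<omega>. (Y \<omega>)\<^sup>2) / (2 * s)\<^sup>2"
    using False s by (intro integral_Markov_inequality_measure[OF int, where A = "{}"]) auto
  also have "\<dots> = 1 / 4" using False by (simp add: E power_mult_distrib)
  finally show ?thesis .
qed

text \<open>Hoeffding's inequality for \<open>K\<close> indicators with values in [0, 1]: a
  deviation of \<open>K / 4\<close> above the mean has exponent
  \<open>-2 * (K / 4)\<^sup>2 / K\<close>, which is \<open>- K / 8\<close>.\<close>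

lemma prob_half_of_events_le:
  assumes ind: "indep_vars (\<lambda>_. borel) Y {1..K}" and K: "K > 0"
    and A: "A \<in> sets borel"
    and prob: "\<And>j. j \<in> {1..K} \<Longrightarrow> prob {\<omega>\<in>space M. Y j \<omega> \<in> A} \<le> 1 / 4"
  shows "prob {\<omega>\<in>space M. real (card {j\<in>{1..K}. Y j \<omega> \<in> A}) \<ge> real K / 2} \<le> exp (- real K / 8)"
proof -
  define Z where "Z = (\<lambda>j \<omega>. indicat_real A (Y j \<omega>))"
  have indZ: "indep_vars (\<lambda>_. borel) Z {1..K}"
    unfolding Z_def using A by (intro indep_vars_compose2[OF ind]) auto
  define E where "E = (\<Sum>j\<in>{1..K}. expectation (Z j))"
  interpret Z: Hoeffding_ineq M "{1..K}" Z "\<lambda>_. 0" "\<lambda>_. 1" E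
  proof unfold_locales
    show "AE \<omega> in M. Z j \<omega> \<in> {0..1}" for j by (simp add: Z_def indicator_def)
  qed (use indZ in \<open>simp_all add: E_def\<close>)
  have "expectation (Z j) \<le> 1 / 4" if j: "j \<in> {1..K}" for j
  proof -
    have [measurable]: "Y j \<in> borel_measurable M" using ind j by (auto simp: indep_vars_def)
    have "expectation (Z j) = expectation (indicat_real {\<omega>\<in>space M. Y j \<omega> \<in> A})"
      by (intro Bochner_Integration.integral_cong) (auto simp: Z_def indicator_def)
    also have "\<dots> = prob {\<omega>\<in>space M. Y j \<omega> \<in> A}"
      using A by simp
    finally show ?thesis using prob[OF j] by simp
  qed
  then have "E \<le> (\<Sum>j\<in>{1..K}. 1 / 4)" unfolding E_def by (rule sum_mono)
  then have E: "E \<le> real K / 4" by simp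
  have count: "(\<Sum>j\<in>{1..K}. Z j \<omega>) = real (card {j\<in>{1..K}. Y j \<omega> \<in> A})" for \<omega>
    by (simp add: Z_def indicator_def sum.If_cases Int_def)
  \<comment> \<open>The mean \<open>E\<close> is at most \<open>K / 4\<close>, so a count of at
    least \<open>K / 2\<close> exceeds it by at least \<open>K / 4\<close>.\<close>
  have "prob {\<omega>\<in>space M. real (card {j\<in>{1..K}. Y j \<omega> \<in> A}) \<ge> real K / 2} \<le>
      prob {\<omega>\<in>space M. (\<Sum>j\<in>{1..K}. Z j \<omega>) \<ge> E + real K / 4}"
  proof (rule finite_measure_mono)
    show "{\<omega>\<in>space M. real (card {j\<in>{1..K}. Y j \<omega> \<in> A}) \<ge> real K / 2} \<subseteq>
        {\<omega>\<in>space M. (\<Sum>j\<in>{1..K}. Z j \<omega>) \<ge> E + real K / 4}"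
      unfolding count using E by auto
    have [measurable]: "Z j \<in> borel_measurable M" if "j \<in> {1..K}" for j
      using that by (rule Z.random_variable)
    show "{\<omega>\<in>space M. (\<Sum>j\<in>{1..K}. Z j \<omega>) \<ge> E + real K / 4} \<in> events"
      by measurable
  qed
  also have "\<dots> \<le> exp (-2 * (real K / 4)\<^sup>2 / (\<Sum>j\<in>{1..K}. (1 - 0)\<^sup>2))"
    using K by (intro Z.Hoeffding_ineq_ge) auto
  also have "\<dots> = exp (- real K / 8)"
    using K by (simp add: power2_eq_square field_simps)
  finally show ?thesis .
qed

end

theorem theorem2:
  fixes \<Omega> :: "'w measure"
    and P :: "'s measure"
    and X :: "nat \<Rightarrow> 'w \<Rightarrow> 's"
    and \<mu> :: "'m::polish_space"
    and T :: "(nat \<Rightarrow> 's) \<Rightarrow> 'm"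
    and \<mu>_est :: "nat \<Rightarrow> 'w \<Rightarrow> 'm"
    and \<mu>_star :: "'w \<Rightarrow> 'm"
    and g :: "nat \<times> nat \<Rightarrow> nat"
    and \<delta> :: real
    and n K L :: nat
  assumes "prob_space \<Omega>"
    and "prob_space.indep_vars \<Omega> (\<lambda>_. P) X {1..n}"
    and "\<And>i. i \<in> {1..n} \<Longrightarrow> distr \<Omega> P (X i) = P"
    and "0 < \<delta>" and "\<delta> < 1"
    and "K = nat \<lceil>8 * ln (inverse \<delta>)\<rceil>"
    and "real n / real K = real L" and "L \<ge> 1"
    and "is_split n K L g"
    and "T \<in> (\<Pi>\<^sub>M i\<in>{1..L}. P) \<rightarrow>\<^sub>M borel"
    and "\<And>j. j \<in> {1..K} \<Longrightarrow> \<mu>_est j = group_estimator T X g L j"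
    and "\<mu>_star \<in> \<Omega> \<rightarrow>\<^sub>M borel"
    and "\<And>\<omega>. \<omega> \<in> space \<Omega> \<Longrightarrow>
           is_arg_min (majority_radius K (\<lambda>j. \<mu>_est j \<omega>)) (\<lambda>_. True) (\<mu>_star \<omega>)"
  shows "\<P>(\<omega> in \<Omega>. ennreal (dist (\<mu>_star \<omega>) \<mu>)
            > 4 * ennreal_sqrt (\<integral>\<^sup>+ \<omega>. ennreal ((dist (\<mu>_est 1 \<omega>) \<mu>)\<^sup>2) \<partial>\<Omega>)) \<le> \<delta>"
proof -
  interpret prob_space \<Omega> by fact
  have ln: "ln (inverse \<delta>) > 0" using \<open>0 < \<delta>\<close> \<open>\<delta> < 1\<close> by (simp add: ln_inverse)
  have K_ge: "real K \<ge> 8 * ln (inverse \<delta>)"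
    unfolding assms(6) by (rule real_nat_ceiling_ge)
  have K: "K > 0" using K_ge ln by linarith
  define S where "S = (\<integral>\<^sup>+ \<omega>. ennreal ((dist (\<mu>_est 1 \<omega>) \<mu>)\<^sup>2) \<partial>\<Omega>)"
  have indep: "indep_vars (\<lambda>_. borel) \<mu>_est {1..K}"
    using indep_vars_group_estimator[OF assms(2,9,10)] assms(11)
    by (subst indep_vars_cong[OF refl _ refl]) auto
  have meas: "\<mu>_est j \<in> borel_measurable \<Omega>" if "j \<in> {1..K}" for j
    using indep that by (auto simp: indep_vars_def)
  have distr: "distr \<Omega> borel (\<mu>_est j) = distr \<Omega> borel (\<mu>_est 1)" if "j \<in> {1..K}" for j
    using distr_group_estimator[OF assms(2,9,10,3,8)] assms(11) that K by simp
  \<comment> \<open>The second moment is an integral against the law of the estimator, which is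
    common to all groups.\<close>
  have moment: "(\<integral>\<^sup>+ \<omega>. ennreal ((dist (\<mu>_est j \<omega>) \<mu>)\<^sup>2) \<partial>\<Omega>) = S" if j: "j \<in> {1..K}" for j
  proof -
    have "(\<integral>\<^sup>+ \<omega>. ennreal ((dist (\<mu>_est j \<omega>) \<mu>)\<^sup>2) \<partial>\<Omega>)
        = (\<integral>\<^sup>+ x. ennreal ((dist x \<mu>)\<^sup>2) \<partial>distr \<Omega> borel (\<mu>_est j))"
      using meas[OF j] by (subst nn_integral_distr) auto
    also have "\<dots> = S"
      unfolding distr[OF j] S_def using meas[of 1] K by (subst nn_integral_distr) auto
    finally show ?thesis .
  qed
  show ?thesis
  \<comment> \<open>An infinite second moment makes the bound infinite; no distance exceeds it, so
    the event is empty. Otherwise \<open>s\<close> is a real number.\<close>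
  proof (cases "S = \<infinity>")
    case True
    with \<open>0 < \<delta>\<close> show ?thesis
      unfolding S_def[symmetric] by (simp add: ennreal_sqrt_def ennreal_mult_top)
  next
    case False
    define s where "s = sqrt (enn2real S)"
    have s: "s \<ge> 0" and S: "S = ennreal (s\<^sup>2)"
      using False by (simp_all add: s_def less_top)
    have rhs: "4 * ennreal_sqrt S = ennreal (4 * s)"
      using False s by (simp add: ennreal_sqrt_def s_def ennreal_mult)
    define A where "A = {x. dist x \<mu> > 2 * s}"
    have A: "A \<in> sets borel" unfolding A_def by measurable
    have "prob {\<omega>\<in>space \<Omega>. \<mu>_est j \<omega> \<in> A} \<le> 1 / 4" if j: "j \<in> {1..K}" for j
      unfolding A_def mem_Collect_eq
      using meas[OF j] moment[OF j] s S by (intro prob_gt_twice_root_second_moment_le) auto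
    then have "prob {\<omega>\<in>space \<Omega>. real (card {j\<in>{1..K}. \<mu>_est j \<omega> \<in> A}) \<ge> real K / 2}
        \<le> exp (- real K / 8)"
      by (rule prob_half_of_events_le[OF indep K A])
    \<comment> \<open>This is what the choice of \<open>K\<close> is made for: rounding up keeps
      \<open>K / 8\<close> at least \<open>ln (inverse \<delta>)\<close>, that is,
      \<open>- ln \<delta>\<close>.\<close>
    also have "\<dots> \<le> exp (ln \<delta>)"
      unfolding exp_le_cancel_iff using K_ge \<open>0 < \<delta>\<close> by (simp add: ln_inverse)
    also have "\<dots> = \<delta>" using \<open>0 < \<delta>\<close> by simp
    finally have bound:
      "prob {\<omega>\<in>space \<Omega>. real (card {j\<in>{1..K}. \<mu>_est j \<omega> \<in> A}) \<ge> real K / 2} \<le> \<delta>" .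
    have "prob {\<omega>\<in>space \<Omega>. ennreal (dist (\<mu>_star \<omega>) \<mu>) > 4 * ennreal_sqrt S}
        \<le> prob {\<omega>\<in>space \<Omega>. real (card {j\<in>{1..K}. \<mu>_est j \<omega> \<in> A}) \<ge> real K / 2}"
    proof (rule finite_measure_mono)
      show "{\<omega>\<in>space \<Omega>. ennreal (dist (\<mu>_star \<omega>) \<mu>) > 4 * ennreal_sqrt S}
          \<subseteq> {\<omega>\<in>space \<Omega>. real (card {j\<in>{1..K}. \<mu>_est j \<omega> \<in> A}) \<ge> real K / 2}"
      proof (intro subsetI CollectI conjI)
        fix \<omega> assume \<omega>: "\<omega> \<in> {\<omega>\<in>space \<Omega>. ennreal (dist (\<mu>_star \<omega>) \<mu>) > 4 * ennreal_sqrt S}"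
        then show space: "\<omega> \<in> space \<Omega>" by simp
        let ?G = "{j\<in>{1..K}. dist (\<mu>_est j \<omega>) \<mu> \<le> 2 * s}"
        have "dist (\<mu>_star \<omega>) \<mu> > 4 * s"
          using \<omega> s by (simp add: rhs ennreal_less_iff)
        \<comment> \<open>Contrapositive of the deterministic bound with radius
          \<open>2 * s\<close>. As the indices in \<open>?G\<close> and those with estimator in
          \<open>A\<close> partition \<open>{1..K}\<close>, failing to have a strict majority in
          \<open>?G\<close> leaves at least half of them in \<open>A\<close>.\<close>
        then have "\<not> real (card ?G) > real K / 2"
          using dist_arg_min_majority_radius_le[OF K assms(13)[OF space], of \<mu> "2 * s"] by auto
        moreover have "card (?G \<union> {j\<in>{1..K}. \<mu>_est j \<omega> \<in> A})
            = card ?G + card {j\<in>{1..K}. \<mu>_est j \<omega> \<in> A}"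
          by (intro card_Un_disjoint) (auto simp: A_def)
        moreover have "?G \<union> {j\<in>{1..K}. \<mu>_est j \<omega> \<in> A} = {1..K}" by (auto simp: A_def)
        ultimately show "real (card {j\<in>{1..K}. \<mu>_est j \<omega> \<in> A}) \<ge> real K / 2" by simp
      qed
      \<comment> \<open>The random cardinality is measurable because it is a finite sum of
        measurable indicators.\<close>
      have "(\<lambda>\<omega>. indicat_real A (\<mu>_est j \<omega>)) \<in> borel_measurable \<Omega>" if "j \<in> {1..K}" for j
        using meas[OF that] A by measurable
      then have "(\<lambda>\<omega>. \<Sum>j\<in>{1..K}. indicat_real A (\<mu>_est j \<omega>)) \<in> borel_measurable \<Omega>"
        by (rule borel_measurable_sum)
      moreover have "(\<Sum>j\<in>{1..K}. indicat_real A (\<mu>_est j \<omega>))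
          = real (card {j\<in>{1..K}. \<mu>_est j \<omega> \<in> A})" for \<omega>
        by (simp add: indicator_def sum.If_cases Int_def)
      ultimately have [measurable]:
        "(\<lambda>\<omega>. real (card {j\<in>{1..K}. \<mu>_est j \<omega> \<in> A})) \<in> borel_measurable \<Omega>"
        by (simp only:)
      show "{\<omega>\<in>space \<Omega>. real (card {j\<in>{1..K}. \<mu>_est j \<omega> \<in> A}) \<ge> real K / 2} \<in> events"
        by measurable
    qed
    with bound show ?thesis unfolding S_def[symmetric] by linarith
  qed
qed

end
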